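(* Let $k$ and $q$ be positive integers with $q$ relatively prime to $2k$. Then $$G(2k+2q,q)=G(2k,q)+\tfrac12=G(2k,-q)+\tfrac12.$$
   Context: For a positive integer $k$, an integer $q$ relatively prime to $2k$ (possibly negative), and an arbitrary integer $i$, define $$g(2k,q,i)=\frac12(2k-1)-\frac1k\sum_{j=0}^{k-1}[i+qj],$$ where $[m]$ is the least nonnegative residue of $m$ modulo $2k$. Define $G(2k,q)=\max_{i\in\mathbb{Z}}g(2k,q,i)$ (the function $g(2k,q,i)$ is periodic in $i$ with period $2k$). In $G(2k+2q,q)$ the integer $k+q$ plays the role of $k$. *)

theory Defs
  imports Complex_Main
begin

text \<open>
  The argument \<open>k\<close> is half the modulus: \<open>g_res k q i\<close> is \<open>g(2k,q,i)\<close> and \<open>G_res k q\<close>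
  is \<open>G(2k,q)\<close>. So \<open>G(2k+2q,q)\<close> is \<open>G_res (k + q) q\<close>. For \<open>k > 0\<close> the value of
  \<open>m mod (2 * k)\<close> on \<open>int\<close> is the least nonnegative residue, also for negative \<open>m\<close>.
\<close>

definition g_res :: "int \<Rightarrow> int \<Rightarrow> int \<Rightarrow> real" where
  "g_res k q i =
     1 / 2 * of_int (2 * k - 1)
     - 1 / of_int k * (\<Sum>j\<in>{0..<k}. of_int ((i + q * j) mod (2 * k)))"

definition G_res :: "int \<Rightarrow> int \<Rightarrow> real" where
  "G_res k q = Max (range (g_res k q))"

text \<open>
  \<open>Max\<close> is only meaningful on finite nonempty sets; the next facts show that it is here the
  maximum of \<open>g_res k q\<close> over all integers.
\<close>

lemma g_res_mod: "g_res k q (i mod (2 * k)) = g_res k q i"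
  by (simp add: g_res_def mod_add_left_eq)

lemma finite_range_g_res:
  assumes "k > 0"
  shows "finite (range (g_res k q))"
proof -
  have "range (g_res k q) \<subseteq> g_res k q ` {0..<2 * k}"
  proof
    fix y assume "y \<in> range (g_res k q)"
    then obtain i where "y = g_res k q i" by blast
    then have "y = g_res k q (i mod (2 * k))" by (simp add: g_res_mod)
    moreover have "i mod (2 * k) \<in> {0..<2 * k}" using assms by simp
    ultimately show "y \<in> g_res k q ` {0..<2 * k}" by blast
  qed
  then show ?thesis by (rule finite_subset) simp
qed

end

theory Submission
  imports Defs
begin

text \<open>
  Everything takes place on the interval \<open>0 \<le> i < k + q\<close>. There the two functions
  \<open>g_res (k + q) q\<close> and \<open>g_res k q\<close> differ by exactly \<open>1 / 2\<close>, and this interval contains all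
  maximisers, reduced modulo the respective period, of both functions.

  For the first claim, writing residues by means of floors turns \<open>g_res k q i\<close> into an explicit
  term plus \<open>2 * (\<Sum>j. (i + q * j) div (2 * k))\<close>. This floor sum counts lattice points in a
  triangle. Counting them along the other axis gives a sum of terms \<open>(i - 2 * k * m) div q\<close> with
  \<open>1 \<le> m \<le> (q - 1) / 2\<close> (lemma \<open>floor_sum_swap\<close>), and in that form replacing \<open>k\<close> by \<open>k + q\<close>
  merely subtracts \<open>2 * m\<close> from each term (lemma \<open>g_res_add_half\<close>).

  For the second claim, \<open>g_res k q (i + q) = g_res k q i + 1\<close> whenever the residue of \<open>i\<close> is at
  least \<open>k\<close> (lemma \<open>g_res_step\<close>), so such an \<open>i\<close> is never a maximiser. Hence both maxima are
  attained at residues below \<open>k\<close> and below \<open>k + q\<close>, respectively.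

  The sign of \<open>q\<close> is immaterial because reversing the order of summation only shifts \<open>i\<close>.
\<close>

section \<open>Shifting the argument\<close>

lemma sum_shift_telescope:
  fixes f :: "int \<Rightarrow> int"
  assumes "k \<ge> 0"
  shows "(\<Sum>j\<in>{0..<k}. f (j + 1)) = (\<Sum>j\<in>{0..<k}. f j) - f 0 + f k"
  using assms
proof (induction k rule: int_ge_induct)
  case base
  then show ?case by simp
next
  case (step n)
  have "{0..<n + 1} = insert n {0..<n}" using step.hyps by auto
  with step.IH show ?case by simp
qed

text \<open>
  The sums for \<open>i\<close> and \<open>i + q\<close> share all but one term each. Since \<open>q\<close> is odd, the new term
  belongs to \<open>i + q * k\<close>, which is congruent to \<open>i + k\<close>, so the sum drops by exactly \<open>k\<close>.
\<close>
lemma g_res_step: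
  assumes "k > 0" "odd q" "i mod (2 * k) \<ge> k"
  shows "g_res k q (i + q) = g_res k q i + 1"
proof -
  define r where "r j = (i + q * j) mod (2 * k)" for j
  obtain h where q: "q = 2 * h + 1" using assms(2) by (elim oddE)
  have "r k = (i + k + h * (2 * k)) mod (2 * k)"
    unfolding r_def q by (simp add: algebra_simps)
  also have "\<dots> = (i mod (2 * k) + k) mod (2 * k)"
    by (simp add: mod_add_left_eq)
  also have "\<dots> = (i mod (2 * k) - k + 2 * k) mod (2 * k)"
    by (rule arg_cong[where f = "\<lambda>x. x mod (2 * k)"]) simp
  also have "\<dots> = (i mod (2 * k) - k) mod (2 * k)"
    by (rule mod_add_self2)
  also have "\<dots> = i mod (2 * k) - k"
  proof (rule mod_pos_pos_trivial)
    have "i mod (2 * k) < 2 * k" using assms(1) by simp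
    then show "i mod (2 * k) - k < 2 * k" using assms(1) by linarith
  qed (use assms(3) in simp)
  finally have rk: "r k = r 0 - k" by (simp add: r_def)
  have "(\<Sum>j\<in>{0..<k}. (i + q + q * j) mod (2 * k)) = (\<Sum>j\<in>{0..<k}. r (j + 1))"
    by (simp add: r_def algebra_simps)
  also have "\<dots> = (\<Sum>j\<in>{0..<k}. r j) - k"
    using assms(1) rk by (simp add: sum_shift_telescope)
  finally have "(\<Sum>j\<in>{0..<k}. of_int ((i + q + q * j) mod (2 * k))) =
      (\<Sum>j\<in>{0..<k}. of_int (r j)) - (of_int k :: real)"
    by (metis of_int_diff of_int_sum)
  then show ?thesis
    unfolding g_res_def using assms(1) by (simp add: r_def field_simps)
qed

lemma g_res_le_G_res:
  assumes "k > 0"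
  shows "g_res k q i \<le> G_res k q"
  unfolding G_res_def using finite_range_g_res[OF assms] by (intro Max_ge) auto

text \<open>A maximiser with residue at least \<open>k\<close> would be beaten by its shift by \<open>q\<close>.\<close>
lemma G_res_attained:
  assumes "k > 0" "odd q"
  obtains i where "0 \<le> i" "i < k" "G_res k q = g_res k q i"
proof -
  have "G_res k q \<in> range (g_res k q)"
    unfolding G_res_def using finite_range_g_res[OF assms(1)] by (intro Max_in) auto
  then obtain i where i: "G_res k q = g_res k q i" by blast
  have "i mod (2 * k) < k"
  proof (rule ccontr)
    assume "\<not> i mod (2 * k) < k"
    then have "g_res k q (i + q) = G_res k q + 1" using g_res_step[OF assms, of i] i by simp
    then show False using g_res_le_G_res[OF assms(1), of q "i + q"] by simp
  qed
  moreover have "0 \<le> i mod (2 * k)" using assms(1) by simp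
  ultimately show thesis using that[of "i mod (2 * k)"] i by (simp add: g_res_mod)
qed

text \<open>The summand for \<open>j\<close> on the left is the one for \<open>k - 1 - j\<close> on the right.\<close>
lemma g_res_minus: "g_res k (- q) i = g_res k q (i - q * (k - 1))"
proof -
  have "(\<Sum>j\<in>{0..<k}. of_int ((i + - q * j) mod (2 * k))) =
      (\<Sum>j\<in>{0..<k}. of_int ((i - q * (k - 1) + q * j) mod (2 * k)) :: real)"
    by (rule sum.reindex_bij_witness[of _ "\<lambda>j. k - 1 - j" "\<lambda>j. k - 1 - j"])
       (auto simp: algebra_simps)
  then show ?thesis by (simp add: g_res_def)
qed

lemma G_res_minus: "G_res k (- q) = G_res k q"
proof -
  have "g_res k q i \<in> range (g_res k (- q))" for i
    using g_res_minus[of k q "i + q * (k - 1)"] by (metis add_diff_cancel_right' rangeI)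
  then have "range (g_res k (- q)) = range (g_res k q)"
    by (auto simp: g_res_minus)
  then show ?thesis by (simp add: G_res_def)
qed

section \<open>Changing the modulus\<close>

lemma int_le_div_iff:
  fixes d x m :: int
  assumes "d > 0"
  shows "m \<le> x div d \<longleftrightarrow> d * m \<le> x"
proof
  assume "m \<le> x div d"
  then have "d * m \<le> d * (x div d)" using assms by simp
  also have "\<dots> = x - x mod d" by (rule minus_mod_eq_mult_div[symmetric])
  also have "\<dots> \<le> x" using assms by simp
  finally show "d * m \<le> x" .
next
  assume "d * m \<le> x"
  then have "(d * m) div d \<le> x div d" using assms by (rule zdiv_mono1)
  then show "m \<le> x div d" using assms by simp
qed

lemma div_eq_sum_of_bool:
  fixes x d h :: int
  assumes "d > 0" "0 \<le> x" "x < d * (h + 1)"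
  shows "x div d = (\<Sum>m\<in>{1..h}. of_bool (d * m \<le> x))"
proof -
  have le: "m \<le> x div d \<longleftrightarrow> d * m \<le> x" for m
    using assms(1) by (rule int_le_div_iff)
  have "x div d < h + 1" using le[of "h + 1"] assms(3) by linarith
  have "{1..h} \<inter> {m. d * m \<le> x} = {1..x div d}"
  proof (rule set_eqI)
    fix m
    have "m \<le> h" if "m \<le> x div d" using that \<open>x div d < h + 1\<close> by linarith
    then show "m \<in> {1..h} \<inter> {m. d * m \<le> x} \<longleftrightarrow> m \<in> {1..x div d}"
      unfolding Int_iff mem_Collect_eq le[symmetric] atLeastAtMost_iff by blast
  qed
  moreover have "0 \<le> x div d" using assms by (simp add: pos_imp_zdiv_nonneg_iff)
  ultimately show ?thesis by (simp add: of_bool_def sum.If_cases)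
qed

lemma sum_of_bool_ge:
  fixes a q k :: int
  assumes "q > 0" "- k \<le> a div q" "a div q \<le> 0"
  shows "(\<Sum>j\<in>{0..<k}. of_bool (- a \<le> q * j)) = k + a div q"
proof -
  have le: "- a \<le> q * j \<longleftrightarrow> - (a div q) \<le> j" for j
    using int_le_div_iff[OF assms(1), of "- j" a]
    by (simp only: mult_minus_right) linarith
  have "{0..<k} \<inter> {j. - a \<le> q * j} = {- (a div q)..<k}"
  proof (rule set_eqI)
    fix j
    have "0 \<le> j" if "- (a div q) \<le> j" using that assms(3) by linarith
    then show "j \<in> {0..<k} \<inter> {j. - a \<le> q * j} \<longleftrightarrow> j \<in> {- (a div q)..<k}"
      unfolding Int_iff mem_Collect_eq le atLeastLessThan_iff by blast
  qed
  then show ?thesis using assms(2) by (simp add: of_bool_def sum.If_cases)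
qed

text \<open>
  Both sides count the pairs \<open>(j, m)\<close> with \<open>0 \<le> j < k\<close>, \<open>m \<ge> 1\<close> and \<open>2 * k * m \<le> i + q * j\<close>. The
  bound \<open>i < k + q\<close> is what limits \<open>m\<close> to \<open>h = (q - 1) / 2\<close>, as it gives
  \<open>i + q * j < k * (q + 1)\<close>.
\<close>
lemma floor_sum_swap:
  fixes i k q h :: int
  assumes "k > 0" "q = 2 * h + 1" "h \<ge> 0" "0 \<le> i" "i < k + q"
  shows "(\<Sum>j\<in>{0..<k}. (i + q * j) div (2 * k)) =
    k * h + (\<Sum>m\<in>{1..h}. (i - 2 * k * m) div q)"
proof -
  have q: "q > 0" using assms by simp
  have column: "(i + q * j) div (2 * k) = (\<Sum>m\<in>{1..h}. of_bool (2 * k * m \<le> i + q * j))"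
    if "j \<in> {0..<k}" for j
  proof (rule div_eq_sum_of_bool)
    show "0 \<le> i + q * j" using that q assms by simp
    have "q * j \<le> q * (k - 1)" using that q by (intro mult_left_mono) auto
    also have "\<dots> = 2 * k * (h + 1) - k - q" using assms(2) by (simp add: algebra_simps)
    finally show "i + q * j < 2 * k * (h + 1)" using assms(5) by linarith
  qed (use assms in simp)
  have row: "(\<Sum>j\<in>{0..<k}. of_bool (2 * k * m \<le> i + q * j)) = k + (i - 2 * k * m) div q"
    if "m \<in> {1..h}" for m
  proof -
    have "k * m \<le> k * h" "k * 1 \<le> k * m"
      using that assms(1) by (simp_all del: mult_1_right)
    moreover have "- k * q = - (2 * (k * h)) - k" "2 * k * m = 2 * (k * m)"
      using assms(2) by (simp_all add: algebra_simps)
    ultimately have bounds: "- k * q \<le> i - 2 * k * m" "i - 2 * k * m < q"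
      using assms by linarith+
    have lower: "- k \<le> (i - 2 * k * m) div q"
      using bounds(1) by (simp only: int_le_div_iff[OF q] mult.commute)
    have "(i - 2 * k * m) div q \<le> (q - 1) div q" using bounds(2) q by (intro zdiv_mono1) auto
    also have "\<dots> = 0" using q by simp
    finally have upper: "(i - 2 * k * m) div q \<le> 0" .
    have "(\<Sum>j\<in>{0..<k}. of_bool (2 * k * m \<le> i + q * j)) =
        (\<Sum>j\<in>{0..<k}. of_bool (- (i - 2 * k * m) \<le> q * j) :: int)"
      by (intro sum.cong arg_cong[of _ _ of_bool]) auto
    then show ?thesis using sum_of_bool_ge[OF q lower upper] by simp
  qed
  have "(\<Sum>j\<in>{0..<k}. (i + q * j) div (2 * k)) =
      (\<Sum>j\<in>{0..<k}. \<Sum>m\<in>{1..h}. of_bool (2 * k * m \<le> i + q * j))"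
    by (intro sum.cong column) auto
  also have "\<dots> = (\<Sum>m\<in>{1..h}. \<Sum>j\<in>{0..<k}. of_bool (2 * k * m \<le> i + q * j))"
    by (rule sum.swap)
  also have "\<dots> = (\<Sum>m\<in>{1..h}. k + (i - 2 * k * m) div q)"
    by (intro sum.cong row) auto
  also have "\<dots> = k * h + (\<Sum>m\<in>{1..h}. (i - 2 * k * m) div q)"
    using assms(3) by (simp add: sum.distrib)
  finally show ?thesis .
qed

lemma two_sum_id_int:
  fixes n :: int
  assumes "n \<ge> 0"
  shows "2 * (\<Sum>j\<in>{0..<n}. j) = n * (n - 1)"
  using assms
proof (induction n rule: int_ge_induct)
  case base
  then show ?case by simp
next
  case (step n)
  have "{0..<n + 1} = insert n {0..<n}" using step.hyps by auto
  with step.IH show ?case by (simp add: algebra_simps)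
qed

text \<open>Substituting \<open>x mod d = x - d * (x div d)\<close> makes the prefactor \<open>1 / k\<close> disappear.\<close>
lemma g_res_eq_floor_sum:
  assumes "k > 0"
  shows "2 * g_res k q i = of_int (2 * k - 1 - 2 * i - q * (k - 1)
    + 4 * (\<Sum>j\<in>{0..<k}. (i + q * j) div (2 * k)))"
proof -
  define F where "F = (\<Sum>j\<in>{0..<k}. (i + q * j) div (2 * k))"
  have "(\<Sum>j\<in>{0..<k}. (i + q * j) mod (2 * k)) =
      (\<Sum>j\<in>{0..<k}. i + q * j - 2 * k * ((i + q * j) div (2 * k)))"
    by (simp only: minus_mult_div_eq_mod)
  also have "\<dots> = k * i + q * (\<Sum>j\<in>{0..<k}. j) - 2 * k * F"
    using assms unfolding F_def by (simp add: sum.distrib sum_subtractf sum_distrib_left)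
  finally have "2 * (\<Sum>j\<in>{0..<k}. (i + q * j) mod (2 * k)) =
      2 * k * i + q * (2 * (\<Sum>j\<in>{0..<k}. j)) - 4 * k * F"
    by simp
  also have "\<dots> = k * (2 * i + q * (k - 1) - 4 * F)"
    using assms by (simp add: two_sum_id_int algebra_simps)
  finally have "2 * (\<Sum>j\<in>{0..<k}. of_int ((i + q * j) mod (2 * k))) =
      (of_int (k * (2 * i + q * (k - 1) - 4 * F)) :: real)"
    by (metis of_int_mult of_int_numeral of_int_sum)
  then have "2 * (1 / of_int k * (\<Sum>j\<in>{0..<k}. of_int ((i + q * j) mod (2 * k)))) =
      (of_int (2 * i + q * (k - 1) - 4 * F) :: real)"
    using assms by (simp add: field_simps)
  then show ?thesis
    unfolding g_res_def F_def[symmetric] by (simp add: algebra_simps)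
qed

text \<open>
  In the swapped floor sum, \<open>k\<close> occurs only inside \<open>(i - 2 * k * m) div q\<close>, where adding \<open>q\<close> to
  it is an exact shift by \<open>2 * m\<close>. So the floor sum grows by
  \<open>q * h - h * (h + 1) = h\<^sup>2\<close>.
\<close>
lemma g_res_add_half:
  assumes "k > 0" "q > 0" "odd q" "0 \<le> i" "i < k + q"
  shows "g_res (k + q) q i = g_res k q i + 1 / 2"
proof -
  obtain h where q: "q = 2 * h + 1" using assms(3) by (elim oddE)
  have h: "h \<ge> 0" using assms(2) q by simp
  define F where "F n = (\<Sum>j\<in>{0..<n}. (i + q * j) div (2 * n))" for n
  have shift: "(i - 2 * (k + q) * m) div q = (i - 2 * k * m) div q - 2 * m" for m
  proof -
    have "i - 2 * (k + q) * m = i - 2 * k * m + (- 2 * m) * q" by (simp add: algebra_simps)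
    then show ?thesis using assms(2) by (simp only: div_mult_self1)
  qed
  have sum_m: "2 * (\<Sum>m\<in>{1..h}. m) = h * (h + 1)"
  proof -
    have "{0..<h + 1} = insert 0 {1..h}" using h by auto
    then show ?thesis using two_sum_id_int[of "h + 1"] h by (simp add: algebra_simps)
  qed
  have "F (k + q) = (k + q) * h + (\<Sum>m\<in>{1..h}. (i - 2 * (k + q) * m) div q)"
    unfolding F_def using floor_sum_swap[OF _ q h, of "k + q" i] assms by linarith
  also have "\<dots> = (k + q) * h + (\<Sum>m\<in>{1..h}. (i - 2 * k * m) div q - 2 * m)"
    by (simp only: shift)
  also have "\<dots> = (k * h + (\<Sum>m\<in>{1..h}. (i - 2 * k * m) div q)) + q * h - 2 * (\<Sum>m\<in>{1..h}. m)"
    by (simp add: sum_subtractf sum_distrib_left algebra_simps)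
  also have "\<dots> = F k + q * h - h * (h + 1)"
    unfolding F_def sum_m using floor_sum_swap[OF _ q h, of k i] assms by simp
  finally have F: "F (k + q) = F k + h * h" by (simp add: q algebra_simps)
  have "2 * g_res (k + q) q i =
      of_int (2 * (k + q) - 1 - 2 * i - q * (k + q - 1) + 4 * F (k + q))"
    unfolding F_def by (rule g_res_eq_floor_sum) (use assms in simp)
  also have "2 * (k + q) - 1 - 2 * i - q * (k + q - 1) + 4 * F (k + q) =
      2 * k - 1 - 2 * i - q * (k - 1) + 4 * F k + 1"
    unfolding F by (simp add: q algebra_simps)
  also have "of_int \<dots> = 2 * g_res k q i + 1"
    unfolding F_def of_int_add[of _ 1] of_int_1 g_res_eq_floor_sum[OF assms(1)] by (rule refl)
  finally show ?thesis by simp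
qed

theorem propositionA1:
  fixes k q :: int
  assumes "k > 0" and "q > 0" and "coprime q (2 * k)"
  shows "G_res (k + q) q = G_res k q + 1 / 2 \<and>
         G_res k q + 1 / 2 = G_res k (- q) + 1 / 2"
proof -
  have odd: "odd q" using assms(3) by auto
  have K: "k + q > 0" using assms by simp
  obtain i where i: "0 \<le> i" "i < k" "G_res k q = g_res k q i"
    using G_res_attained[OF assms(1) odd] .
  have "G_res k q + 1 / 2 = g_res (k + q) q i"
    using g_res_add_half[OF assms(1,2) odd, of i] i assms(2) by simp
  then have ge: "G_res k q + 1 / 2 \<le> G_res (k + q) q"
    using g_res_le_G_res[OF K] by simp
  obtain i' where i': "0 \<le> i'" "i' < k + q" "G_res (k + q) q = g_res (k + q) q i'"
    using G_res_attained[OF K odd] .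
  have "G_res (k + q) q = g_res k q i' + 1 / 2"
    using g_res_add_half[OF assms(1,2) odd, of i'] i' by simp
  then have "G_res (k + q) q \<le> G_res k q + 1 / 2"
    using g_res_le_G_res[OF assms(1)] by simp
  with ge show ?thesis by (simp add: G_res_minus)
qed

end
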